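(* If $A$ is infinite, then the axiomatization consisting of A1-4, IF1 and IF2 is $\omega$-complete for BCCSP($A$).
   Context: $A$ is a nonempty countable set of actions. BCCSP($A$) terms: $t::=0\mid x\mid at\mid t+t$ ($x$ from a countably infinite set of variables, $a\in A$). Inequational logic: reflexivity, transitivity, substitution instances of axioms, closure under prefix and $+$ contexts; an equation abbreviates two inequations. $\omega$-complete: for all BCCSP($A$) terms $t,u$, if $\rho(t)\preccurlyeq\rho(u)$ is derivable for every closed substitution $\rho$, then $t\preccurlyeq u$ is derivable. Axioms (for every $a\in A$): A1: $x+y\approx y+x$; A2: $(x+y)+z\approx x+(y+z)$; A3: $x+x\approx x$; A4: $x+0\approx x$; IF1: $a(x+y)\preccurlyeq ax+ay$; IF2: $ax+a(y+z)\approx a(x+y)+ax+a(y+z)$. *)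

theory Defs
  imports Main "HOL-Library.Countable_Set"
begin

(* The action set A is the whole type 'a, the set of variables is the whole type 'v. *)
datatype (acts: 'a, vars: 'v) bccsp =
    Stop ("\<zero>")
  | Var 'v
  | Prefix 'a "('a, 'v) bccsp" (infixr "\<cdot>" 75)
  | Choice "('a, 'v) bccsp" "('a, 'v) bccsp" (infixl "\<oplus>" 65)

type_synonym ('a, 'v) subst = "'v \<Rightarrow> ('a, 'v) bccsp"

primrec subst :: "('a, 'v) subst \<Rightarrow> ('a, 'v) bccsp \<Rightarrow> ('a, 'v) bccsp" where
  "subst \<sigma> \<zero> = \<zero>"
| "subst \<sigma> (Var x) = \<sigma> x"
| "subst \<sigma> (a \<cdot> t) = a \<cdot> subst \<sigma> t"
| "subst \<sigma> (t \<oplus> u) = subst \<sigma> t \<oplus> subst \<sigma> u"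

definition closed_subst :: "('a, 'v) subst \<Rightarrow> bool" where
  "closed_subst \<rho> \<longleftrightarrow> (\<forall>x. vars (\<rho> x) = {})"

(* A pair (t, u) stands for the inequation between t and u, with t on the smaller side. *)
type_synonym ('a, 'v) inequations = "(('a, 'v) bccsp \<times> ('a, 'v) bccsp) set"

definition equation :: "('a, 'v) bccsp \<Rightarrow> ('a, 'v) bccsp \<Rightarrow> ('a, 'v) inequations" where
  "equation t u = {(t, u), (u, t)}"

inductive derivable :: "('a, 'v) inequations \<Rightarrow> ('a, 'v) bccsp \<Rightarrow> ('a, 'v) bccsp \<Rightarrow> bool"
  for E :: "('a, 'v) inequations" where
  refl: "derivable E t t"
| trans: "derivable E t u \<Longrightarrow> derivable E u v \<Longrightarrow> derivable E t v"
| inst: "(t, u) \<in> E \<Longrightarrow> derivable E (subst \<sigma> t) (subst \<sigma> u)"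
| prefix: "derivable E t u \<Longrightarrow> derivable E (a \<cdot> t) (a \<cdot> u)"
| choice_left: "derivable E t u \<Longrightarrow> derivable E (t \<oplus> v) (u \<oplus> v)"
| choice_right: "derivable E t u \<Longrightarrow> derivable E (v \<oplus> t) (v \<oplus> u)"

definition omega_complete :: "('a, 'v) inequations \<Rightarrow> bool" where
  "omega_complete E \<longleftrightarrow>
     (\<forall>t u. (\<forall>\<rho>. closed_subst \<rho> \<longrightarrow> derivable E (subst \<rho> t) (subst \<rho> u)) \<longrightarrow> derivable E t u)"

definition ax_A1 :: "'v \<Rightarrow> 'v \<Rightarrow> ('a, 'v) inequations" where
  "ax_A1 x y = equation (Var x \<oplus> Var y) (Var y \<oplus> Var x)"

definition ax_A2 :: "'v \<Rightarrow> 'v \<Rightarrow> 'v \<Rightarrow> ('a, 'v) inequations" where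
  "ax_A2 x y z = equation ((Var x \<oplus> Var y) \<oplus> Var z) (Var x \<oplus> (Var y \<oplus> Var z))"

definition ax_A3 :: "'v \<Rightarrow> ('a, 'v) inequations" where
  "ax_A3 x = equation (Var x \<oplus> Var x) (Var x)"

definition ax_A4 :: "'v \<Rightarrow> ('a, 'v) inequations" where
  "ax_A4 x = equation (Var x \<oplus> \<zero>) (Var x)"

definition ax_IF1 :: "'v \<Rightarrow> 'v \<Rightarrow> ('a, 'v) inequations" where
  "ax_IF1 x y = (\<Union>a. {(a \<cdot> (Var x \<oplus> Var y), a \<cdot> Var x \<oplus> a \<cdot> Var y)})"

definition ax_IF2 :: "'v \<Rightarrow> 'v \<Rightarrow> 'v \<Rightarrow> ('a, 'v) inequations" where
  "ax_IF2 x y z = (\<Union>a. equation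
     (a \<cdot> Var x \<oplus> a \<cdot> (Var y \<oplus> Var z))
     (a \<cdot> (Var x \<oplus> Var y) \<oplus> a \<cdot> Var x \<oplus> a \<cdot> (Var y \<oplus> Var z)))"

end

theory Submission
  imports Defs
begin

text \<open>
  Interpret the variables of the two given terms as processes performing a single action, with
  distinct actions that do not occur in the terms. A derivation between the resulting closed terms
  is turned back into a derivation between the given terms by replacing each subterm that starts
  with such a fresh action by the variable that the action encodes (Groote's inverted
  substitutions). The instances of IF1 and IF2 at a fresh action become inequations between sums
  of copies of one variable, which follow from A3.
\<close>

text \<open>The continuation of a fresh action is discarded, since a derivation may rewrite
  \<open>a \<cdot> \<zero>\<close> to \<open>a \<cdot> (\<zero> \<oplus> \<zero>)\<close>.\<close>

primrec decode :: "('a \<Rightarrow> 'v option) \<Rightarrow> ('a, 'v) bccsp \<Rightarrow> ('a, 'v) bccsp" where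
  "decode g \<zero> = \<zero>"
| "decode g (Var x) = Var x"
| "decode g (a \<cdot> t) = (case g a of None \<Rightarrow> a \<cdot> decode g t | Some v \<Rightarrow> Var v)"
| "decode g (t \<oplus> u) = decode g t \<oplus> decode g u"

lemma decode_subst:
  assumes "\<And>a. a \<in> acts t \<Longrightarrow> g a = None"
  shows "decode g (subst \<sigma> t) = subst (decode g \<circ> \<sigma>) t"
  using assms by (induction t) auto

lemma subst_eq_self:
  assumes "\<And>v. v \<in> vars t \<Longrightarrow> \<sigma> v = Var v"
  shows "subst \<sigma> t = t"
  using assms by (induction t) auto

lemma derivable_decode:
  assumes "\<And>t u \<sigma>. (t, u) \<in> E \<Longrightarrow> derivable E (decode g (subst \<sigma> t)) (decode g (subst \<sigma> u))"
    and "derivable E t u"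
  shows "derivable E (decode g t) (decode g u)"
  using assms(2)
proof (induction rule: derivable.induct)
  case (trans t u v)
  then show ?case by (blast intro: derivable.trans)
next
  case (prefix t u a)
  \<comment> \<open>For a fresh \<open>a\<close> both sides decode to the same variable.\<close>
  then show ?case by (cases "g a") (auto intro: derivable.intros)
qed (auto intro: derivable.intros assms(1))

lemma finite_acts: "finite (acts t)"
  by (induction t) auto

lemma finite_vars: "finite (vars t)"
  by (induction t) auto

theorem theorem6p2:
  fixes x y z :: 'v
  assumes "countable (UNIV :: 'a set)" and "infinite (UNIV :: 'a set)"
    and "countable (UNIV :: 'v set)" and "infinite (UNIV :: 'v set)"
    and "distinct [x, y, z]"
  shows "omega_complete
    (ax_A1 x y \<union> ax_A2 x y z \<union> ax_A3 x \<union> ax_A4 x \<union> ax_IF1 x y \<union> ax_IF2 x y z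
      :: ('a, 'v) inequations)"
    (is "omega_complete ?E")
  unfolding omega_complete_def
proof (intro allI impI)
  fix t u :: "('a, 'v) bccsp"
  assume closed: "\<forall>\<rho>. closed_subst \<rho> \<longrightarrow> derivable ?E (subst \<rho> t) (subst \<rho> u)"
  define V where "V = vars t \<union> vars u"
  have "infinite (UNIV - (acts t \<union> acts u))"
    using assms(2) by (simp add: finite_acts)
  then obtain B where B: "finite B" "card B = card V" "B \<subseteq> UNIV - (acts t \<union> acts u)"
    using infinite_arbitrarily_large by meson
  have "finite V" by (simp add: V_def finite_vars)
  then obtain f where "f ` V \<subseteq> B" and inj: "inj_on f V"
    using card_le_inj[of V B] B(1,2) by auto
  then have fresh: "f ` V \<subseteq> UNIV - (acts t \<union> acts u)" using B(3) by blast
  \<comment> \<open>Only the finitely many variables in \<open>V\<close> need a code;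
    \<open>\<zero>\<close> elsewhere keeps \<open>\<rho>\<close> closed.\<close>
  define \<rho> :: "('a, 'v) subst" where "\<rho> v = (if v \<in> V then f v \<cdot> \<zero> else \<zero>)" for v
  define g where "g a = (if a \<in> f ` V then Some (inv_into V f a) else None)" for a
  have "closed_subst \<rho>" by (simp add: closed_subst_def \<rho>_def)
  then have derivable: "derivable ?E (subst \<rho> t) (subst \<rho> u)" using closed by blast
  have decode_\<rho>: "decode g (subst \<rho> s) = s" if "s \<in> {t, u}" for s
  proof -
    have "decode g (subst \<rho> s) = subst (decode g \<circ> \<rho>) s"
      using that fresh by (intro decode_subst) (auto simp: g_def)
    also have "\<dots> = s"
      \<comment> \<open>Injectivity of \<open>f\<close> makes \<open>g\<close> recover
        \<open>v\<close> from \<open>f v\<close>.\<close>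
      using that inj by (intro subst_eq_self) (auto simp: g_def \<rho>_def V_def)
    finally show ?thesis .
  qed
  have A3: "derivable ?E (s \<oplus> s) s" "derivable ?E s (s \<oplus> s)" for s
    using derivable.inst[of "Var x \<oplus> Var x" "Var x" ?E "\<lambda>_. s"]
      derivable.inst[of "Var x" "Var x \<oplus> Var x" ?E "\<lambda>_. s"]
    by (simp_all add: ax_A3_def equation_def)
  have "derivable ?E (decode g (subst \<sigma> l)) (decode g (subst \<sigma> r))" if ax: "(l, r) \<in> ?E" for l r \<sigma>
  proof (cases "\<forall>a \<in> acts l \<union> acts r. g a = None")
    case True
    \<comment> \<open>The decoded pair is the instance of the same axiom under
      \<open>decode g \<circ> \<sigma>\<close>.\<close>
    then show ?thesis using ax by (simp add: decode_subst derivable.inst)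
  next
    case False
    \<comment> \<open>A1 to A4 contain no action, so the axiom is IF1 (first disjunct) or IF2 in
      either direction (second), and \<open>v\<close> is the variable encoded by its only
      action.\<close>
    then obtain v where "decode g (subst \<sigma> l) = Var v \<and> decode g (subst \<sigma> r) = Var v \<oplus> Var v \<or>
        (decode g (subst \<sigma> l), decode g (subst \<sigma> r))
          \<in> equation (Var v \<oplus> Var v) (Var v \<oplus> Var v \<oplus> Var v)"
      using ax
      by (auto simp: ax_A1_def ax_A2_def ax_A3_def ax_A4_def ax_IF1_def ax_IF2_def equation_def)
    then show ?thesis
      by (auto simp: equation_def A3 derivable.choice_left)
  qed
  from derivable_decode[OF this derivable] show "derivable ?E t u"
    by (simp add: decode_\<rho>)
qed

end
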